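(* Let $X$ be a metrizable separable topological vector space, let $\alpha$ be an infinite cardinal number, and let $M$ be a nonempty subset of $X$ for which there is a nonempty subset $N$ of $X$ such that (i) $M$ is stronger than $N$, i.e. $M+N\subset M$; (ii) $M\cap N=\varnothing$; (iii) $N$ is dense-lineable in $X$. If $M$ is pointwise $\alpha$-lineable, then $M$ is infinitely pointwise $\alpha$-dense lineable in $X$ (and therefore pointwise $\alpha$-dense lineable in $X$).
   Context: Let $X$ be a topological vector space and $M,N\subset X$; dimensions are algebraic (cardinality of a Hamel basis). Here $M+N=\{m+n : m\in M,\ n\in N\}$. $N$ is dense-lineable in $X$ if $N\cup\{0\}$ contains a vector subspace of $X$ that is dense in $X$. $M$ is pointwise $\alpha$-lineable (respectively pointwise $\alpha$-dense lineable) if for each $x\in M$ there is a vector subspace (respectively a dense vector subspace) $W_x$ of $X$ with $\dim(W_x)=\alpha$ and $x\in W_x\subset M\cup\{0\}$. For an infinite cardinal $\alpha$, $M$ is infinitely pointwise $\alpha$-lineable if for every $x\in M$ there exists a family $\{W_k\}_{k\in\mathbb{N}}$ of vector subspaces of $X$ such that for each $k\in\mathbb{N}$: (i) $\dim(W_k)=\alpha$; (ii) $x\in W_k\subset M\cup\{0\}$; (iii) $W_k\cap W_l=\mathrm{span}\{x\}$ for every $l\in\mathbb{N}$ with $l\neq k$. If additionally (for every $x \in M$, the family can be chosen so that) each $W_k$ is dense in $X$, then $M$ is infinitely pointwise $\alpha$-dense lineable in $X$. *)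

theory Defs
  imports "HOL-Analysis.Analysis"
begin

unbundle cardinal_syntax

(* Up to isomorphism, the instances of real_normed_field are exactly the fields of real and
   of complex numbers with their usual topology (Gelfand-Mazur), so the scalars are real or
   complex.  The sort topological_ab_group_add supplies joint continuity of addition; its
   continuity of negation is automatic, as -x = scale (-1) x.
   No separation axiom is assumed here. *)
locale topological_vector_space = vector_space scale
  for scale :: "'k::real_normed_field \<Rightarrow> 'x::topological_ab_group_add \<Rightarrow> 'x" +
  assumes continuous_scale: "continuous_on UNIV (\<lambda>(c, v). scale c v)"
begin

(* Cardinals are represented, as in the BNF cardinal library, by relations r with Card_order r.
   The library's dim is natural-number valued and hence of no use for infinite dimensions. *)
definition has_dim :: "'x set \<Rightarrow> 'c rel \<Rightarrow> bool" where
  "has_dim W \<alpha> \<longleftrightarrow> (\<exists>B. independent B \<and> span B = W \<and> |B| =o \<alpha>)"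

definition dense_lineable :: "'x set \<Rightarrow> bool" where
  "dense_lineable N \<longleftrightarrow> (\<exists>Y. subspace Y \<and> closure Y = UNIV \<and> Y \<subseteq> N \<union> {0})"

definition pointwise_lineable :: "'c rel \<Rightarrow> 'x set \<Rightarrow> bool" where
  "pointwise_lineable \<alpha> M \<longleftrightarrow>
     (\<forall>x\<in>M. \<exists>W. subspace W \<and> has_dim W \<alpha> \<and> x \<in> W \<and> W \<subseteq> M \<union> {0})"

definition pointwise_dense_lineable :: "'c rel \<Rightarrow> 'x set \<Rightarrow> bool" where
  "pointwise_dense_lineable \<alpha> M \<longleftrightarrow>
     (\<forall>x\<in>M. \<exists>W. subspace W \<and> closure W = UNIV \<and> has_dim W \<alpha> \<and> x \<in> W \<and> W \<subseteq> M \<union> {0})"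

definition infinitely_pointwise_dense_lineable :: "'c rel \<Rightarrow> 'x set \<Rightarrow> bool" where
  "infinitely_pointwise_dense_lineable \<alpha> M \<longleftrightarrow>
     (\<forall>x\<in>M. \<exists>W :: nat \<Rightarrow> 'x set. \<forall>k.
        subspace (W k) \<and> closure (W k) = UNIV \<and> has_dim (W k) \<alpha> \<and>
        x \<in> W k \<and> W k \<subseteq> M \<union> {0} \<and>
        (\<forall>l. l \<noteq> k \<longrightarrow> W k \<inter> W l = span {x}))"

end

(* M + N is the pointwise sum of HOL-Library.Set_Algebras. *)
definition stronger_than :: "'x::plus set \<Rightarrow> 'x set \<Rightarrow> bool" where
  "stronger_than M N \<longleftrightarrow> M + N \<subseteq> M"

end

theory Submission
  imports Defs
begin

text \<open>
  Given \<open>x \<in> M\<close> and a subspace \<open>W \<subseteq> M \<union> {0}\<close> of dimension \<open>\<alpha>\<close> through \<open>x\<close>, countably many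
  subspaces of \<open>W\<close> that share only the line through \<open>x\<close> are spanned by parts of one independent
  set, and each of them is tilted into dense position by a small change of its basis.

  As \<open>M + N \<subseteq> M\<close>, \<open>M \<inter> N = {}\<close> and \<open>N \<noteq> {}\<close>, the zero vector is not in \<open>M\<close>. Let \<open>Y\<close> be a dense
  subspace inside \<open>N \<union> {0}\<close>. Then \<open>M + Y \<subseteq> M\<close> and \<open>M \<inter> Y = {}\<close>, so that \<open>W \<inter> Y = {0}\<close>.
  By the exchange property there is an independent set \<open>insert x A\<close> in \<open>W\<close> with \<open>A\<close> of cardinality
  \<open>\<alpha>\<close>. The space has a countable base \<open>O\<^sub>0, O\<^sub>1, \<dots>\<close> of nonempty open sets, and \<open>|A| = |A \<times> \<nat> \<times> \<nat>|\<close>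
  lets every \<open>a \<in> A\<close> carry a label \<open>(k, j)\<close> such that every label is used \<open>\<alpha>\<close> times.
  For \<open>a\<close> with label \<open>(k, j)\<close> choose \<open>y\<^sub>a \<in> Y \<inter> O\<^sub>j\<close> and then a scalar \<open>c\<^sub>a \<noteq> 0\<close> so small that
  \<open>y\<^sub>a + c\<^sub>a a\<close> is still in \<open>O\<^sub>j\<close>. Let \<open>g\<close> be linear with \<open>g x = x\<close> and \<open>g a = a + c\<^sub>a\<^sup>-\<^sup>1 y\<^sub>a\<close>, and put
  \<open>W\<^sub>k = g (span ({x} \<union> {a \<in> A. a has a label (k, _)}))\<close>.

  Since \<open>g\<close> moves each vector of \<open>span (insert x A) \<subseteq> W\<close> by an element of \<open>Y\<close>, it maps the nonzero
  ones into \<open>M + Y \<subseteq> M\<close>, and it is injective because \<open>W \<inter> Y = {0}\<close>. Injectivity keeps dimensions and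
  intersections: \<open>W\<^sub>k \<inter> W\<^sub>l = g (span {x}) = span {x}\<close>. Finally \<open>W\<^sub>k\<close> is dense, for it contains
  \<open>c\<^sub>a g a = y\<^sub>a + c\<^sub>a a \<in> O\<^sub>j\<close> for some \<open>a\<close> with label \<open>(k, j)\<close>, for every \<open>j\<close>.
\<close>

section \<open>Countable bases of metrizable separable spaces\<close>

text \<open>The balls with centre in a countable dense set and radius \<open>1 / (n + 1)\<close> form a base.\<close>

lemma metrizable_separable_imp_second_countable:
  assumes "metrizable_space X" "separable_space X"
  shows "second_countable X"
proof -
  obtain S d where Sd: "Metric_space S d" and X: "X = Metric_space.mtopology S d"
    using assms(1) unfolding metrizable_space_def by blast
  interpret Metric_space S d by (rule Sd)
  obtain D where D: "countable D" "D \<subseteq> S" "mtopology closure_of D = S"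
    using assms(2) unfolding separable_space_def X by auto
  let ?B = "(\<lambda>(z, n). mball z (1 / real (Suc n))) ` (D \<times> (UNIV :: nat set))"
  have "\<exists>V \<in> ?B. z \<in> V \<and> V \<subseteq> U" if U: "openin mtopology U" and z: "z \<in> U" for U z
  proof -
    obtain r where r: "r > 0" "mball z r \<subseteq> U" and zS: "z \<in> S"
      using U z unfolding openin_mtopology by blast
    obtain n where n: "1 / real (Suc n) < r / 2"
      using r(1) nat_approx_posE[of "r / 2"] by auto
    have "z \<in> mtopology closure_of D"
      using zS D(3) by simp
    then obtain q where q: "q \<in> D" "q \<in> mball z (1 / real (Suc n))"
      unfolding metric_closure_of by (force dest: spec[of _ "1 / real (Suc n)"])
    have qS: "q \<in> S" and dq: "d z q < 1 / real (Suc n)"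
      using q(2) by auto
    have "mball q (1 / real (Suc n)) \<subseteq> mball z r"
    proof
      fix w assume w: "w \<in> mball q (1 / real (Suc n))"
      then have "d z w \<le> d z q + d q w"
        using triangle[of z q w] zS qS by auto
      then show "w \<in> mball z r"
        using w dq n zS by auto
    qed
    moreover have "z \<in> mball q (1 / real (Suc n))"
      using dq zS qS commute[of z q] by auto
    ultimately show ?thesis
      using q(1) r(2) by (intro bexI[of _ "mball q (1 / real (Suc n))"]) auto
  qed
  moreover have "countable ?B"
    using D(1) by auto
  moreover have "\<forall>V \<in> ?B. openin mtopology V"
    by auto
  ultimately show ?thesis
    unfolding second_countable_def X by blast
qed

section \<open>Infinite cardinals\<close>

lemma card_of_insert_infinite:
  assumes "infinite A"
  shows "|insert a A| =o |A|"
proof -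
  have "\<exists>f. bij_betw f A (insert a A)"
    using infinite_imp_bij_betw2[OF assms, of a] by simp
  then have "|A| =o |insert a A|"
    using card_of_ordIso by (rule iffD1[rotated])
  then show ?thesis
    by (rule ordIso_symmetric)
qed

text \<open>An infinite set is equipollent with its product with a countable type; the second
  component of the image is the label.\<close>

lemma infinite_labelling_by_countable:
  assumes "infinite A"
  shows "\<exists>p :: 'a \<Rightarrow> 'b :: countable. \<forall>c. |{a \<in> A. p a = c}| =o |A|"
proof -
  have "|UNIV :: 'b set| \<le>o |UNIV :: nat set|"
    unfolding card_of_ordLeq[symmetric] by (rule exI[of _ to_nat]) auto
  also have "|UNIV :: nat set| \<le>o |A|"
    using assms infinite_iff_card_of_nat by blast
  finally have "|A| =o |A \<times> (UNIV :: 'b set)|"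
    using assms by (intro card_of_Times_infinite_simps) auto
  then obtain f where f: "bij_betw f A (A \<times> (UNIV :: 'b set))"
    using card_of_ordIso by blast
  have "|{a \<in> A. snd (f a) = c}| =o |A|" for c
  proof -
    have "bij_betw (\<lambda>a. fst (f a)) {a \<in> A. snd (f a) = c} A"
      unfolding bij_betw_def
    proof
      show "inj_on (\<lambda>a. fst (f a)) {a \<in> A. snd (f a) = c}"
        using f unfolding bij_betw_def inj_on_def by (auto simp: prod_eq_iff)
      show "(\<lambda>a. fst (f a)) ` {a \<in> A. snd (f a) = c} = A"
      proof
        show "(\<lambda>a. fst (f a)) ` {a \<in> A. snd (f a) = c} \<subseteq> A"
          using bij_betwE[OF f] by (auto simp: mem_Times_iff)
        show "A \<subseteq> (\<lambda>a. fst (f a)) ` {a \<in> A. snd (f a) = c}"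
        proof
          fix b assume "b \<in> A"
          then have "(b, c) \<in> f ` A"
            using f by (simp add: bij_betw_def)
          then obtain a where "a \<in> A" "f a = (b, c)"
            by force
          then show "b \<in> (\<lambda>a. fst (f a)) ` {a \<in> A. snd (f a) = c}"
            by (intro image_eqI[of _ _ a]) auto
        qed
      qed
    qed
    then show ?thesis
      using card_of_ordIso by blast
  qed
  then show ?thesis
    by (intro exI[of _ "\<lambda>a. snd (f a)"]) blast
qed

section \<open>Independent sets\<close>

context vector_space
begin

text \<open>Coordinates with respect to \<open>B\<close> are unique, so the support of a vector in both spans lies in
  both sets.\<close>

lemma span_Int_subsets_of_independent:
  assumes B: "independent B" and "C \<subseteq> B" "D \<subseteq> B"
  shows "span C \<inter> span D = span (C \<inter> D)"
proof
  show "span (C \<inter> D) \<subseteq> span C \<inter> span D"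
    by (simp add: span_mono)
  show "span C \<inter> span D \<subseteq> span (C \<inter> D)"
  proof
    fix v assume v: "v \<in> span C \<inter> span D"
    have "independent C"
      using assms independent_mono by blast
    have "representation B v = representation C v"
      using v assms(2) by (intro representation_extend[OF B]) auto
    moreover have "representation B v = representation D v"
      using v assms(3) by (intro representation_extend[OF B]) auto
    ultimately have "b \<in> C \<inter> D" if "representation C v b \<noteq> 0" for b
      using that representation_ne_zero[of C v b] representation_ne_zero[of D v b] by simp
    then have "(\<Sum>b\<in>{b. representation C v b \<noteq> 0}. representation C v b *s b) \<in> span (C \<inter> D)"
      by (intro span_sum span_scale span_base) auto
    then show "v \<in> span (C \<inter> D)"
      using sum_nonzero_representation_eq[OF \<open>independent C\<close>, of v] v by simp
  qed
qed

text \<open>For an infinite basis this yields an independent set through \<open>x\<close> of visibly the same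
  cardinality, so that the cardinalities of two bases need not be compared. Any \<open>b\<close> with a nonzero coefficient
  in \<open>x\<close> can be exchanged, since coordinates are unique.\<close>

lemma exchange_basis_vector:
  assumes B: "independent B" and x: "x \<in> span B" "x \<noteq> 0"
  shows "\<exists>b\<in>B. x \<notin> B - {b} \<and> independent (insert x (B - {b}))"
proof -
  obtain b where b: "representation B x b \<noteq> 0"
  proof (rule ccontr)
    assume "\<not> thesis"
    then have "representation B x b = 0" for b
      using that by blast
    then show False
      using sum_nonzero_representation_eq[OF B x(1)] x(2) by simp
  qed
  have "x \<notin> span (B - {b})"
  proof
    assume "x \<in> span (B - {b})"
    then have "representation B x = representation (B - {b}) x"
      using B by (intro representation_extend) auto
    then show False
      using b representation_ne_zero[of "B - {b}" x b] by auto
  qed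
  moreover have "independent (B - {b})"
    using B by (rule independent_mono) auto
  ultimately show ?thesis
    using \<open>x \<notin> span (B - {b})\<close> representation_ne_zero[OF b] span_base[of x "B - {b}"]
    by (intro bexI[of _ b] conjI independent_insertI) blast+
qed

end

section \<open>Dense subspaces obtained by tilting\<close>

context topological_vector_space
begin

text \<open>The scalar field is not discrete, so a neighbourhood of \<open>0\<close> contains a nonzero scalar.\<close>

lemma open_contains_small_translate:
  assumes "open U" "y \<in> U"
  shows "\<exists>c. c \<noteq> 0 \<and> y + scale c b \<in> U"
proof -
  have "continuous_on UNIV ((\<lambda>(c, v). scale c v) \<circ> (\<lambda>c. (c, b)))"
    by (intro continuous_on_compose continuous_intros continuous_on_subset[OF continuous_scale]) auto
  then have "continuous_on UNIV (\<lambda>c. y + scale c b)"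
    by (intro continuous_intros) (simp add: o_def)
  then have "open ((\<lambda>c. y + scale c b) -` U)"
    using assms(1) by (simp add: continuous_on_open_vimage)
  moreover have "0 \<in> (\<lambda>c. y + scale c b) -` U"
    using assms(2) by simp
  ultimately show ?thesis
    using not_open_singleton[of "0 :: 'k"] by (cases "(\<lambda>c. y + scale c b) -` U = {0}") auto
qed

text \<open>Every space \<open>V k\<close> is the image of a subspace of \<open>W\<close> under the injective map \<open>g\<close>, which differs
  from the identity by a linear map into \<open>Y\<close>. The upper bound for \<open>V k\<close> keeps track of the fact that
  a nonzero vector of \<open>V k\<close> has a nonzero component in \<open>W\<close>.\<close>

lemma tilted_dense_subspaces:
  assumes second_countable: "second_countable (euclidean :: 'x topology)"
    and \<alpha>: "Cinfinite \<alpha>"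
    and W: "subspace W" "has_dim W \<alpha>" "x \<in> W" "x \<noteq> 0"
    and Y: "subspace Y" "closure Y = UNIV"
    and WY: "W \<inter> Y \<subseteq> {0}"
  shows "\<exists>V :: nat \<Rightarrow> 'x set. \<forall>k.
    subspace (V k) \<and> closure (V k) = UNIV \<and> has_dim (V k) \<alpha> \<and> x \<in> V k \<and>
    V k \<subseteq> insert 0 ((W - {0}) + Y) \<and> (\<forall>l. l \<noteq> k \<longrightarrow> V k \<inter> V l = span {x})"
proof -
  interpret vector_space_pair scale scale ..
  obtain B\<^sub>0 where B\<^sub>0: "independent B\<^sub>0" "span B\<^sub>0 = W" "|B\<^sub>0| =o \<alpha>"
    using W(2) unfolding has_dim_def by blast
  then obtain b\<^sub>0 where b\<^sub>0: "b\<^sub>0 \<in> B\<^sub>0" "x \<notin> B\<^sub>0 - {b\<^sub>0}" "independent (insert x (B\<^sub>0 - {b\<^sub>0}))"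
    using exchange_basis_vector W(3,4) by blast
  define A where "A = B\<^sub>0 - {b\<^sub>0}"
  define B where "B = insert x A"
  have B: "independent B" and xA: "x \<notin> A"
    using b\<^sub>0 by (auto simp: A_def B_def)
  have BW: "span B \<subseteq> W"
    using B\<^sub>0(2) W(1,3) by (intro span_minimal) (auto simp: A_def B_def intro: span_base)
  have infB\<^sub>0: "infinite B\<^sub>0"
    using Cinfinite_cong[OF ordIso_symmetric[OF B\<^sub>0(3)] \<alpha>] by (simp add: cinfinite_def Field_card_of)
  then have infA: "infinite A"
    by (simp add: A_def)
  then have "|insert b\<^sub>0 A| =o |A|"
    by (rule card_of_insert_infinite)
  moreover have "insert b\<^sub>0 A = B\<^sub>0"
    using b\<^sub>0(1) by (auto simp: A_def)
  ultimately have "|A| =o |B\<^sub>0|"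
    using ordIso_symmetric by metis
  then have card_A: "|A| =o \<alpha>"
    using B\<^sub>0(3) ordIso_transitive by blast

  obtain \<B> where \<B>: "countable \<B>" "\<And>V. V \<in> \<B> \<Longrightarrow> open V"
      "\<And>(U :: 'x set) z. open U \<Longrightarrow> z \<in> U \<Longrightarrow> \<exists>V \<in> \<B>. z \<in> V \<and> V \<subseteq> U"
    using second_countable unfolding second_countable_def by auto
  define O' where "O' = from_nat_into (\<B> - {{}})"
  have ne: "\<B> - {{}} \<noteq> {}"
    using \<B>(3)[OF open_UNIV] by blast
  have O': "open (O' j)" "O' j \<noteq> {}" for j
    using from_nat_into[OF ne, of j] \<B>(2) by (auto simp: O'_def)
  have range_O': "range O' = \<B> - {{}}"
    unfolding O'_def using ne \<B>(1) by (intro range_from_nat_into) auto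
  have denseI: "closure S = UNIV" if "\<And>j. S \<inter> O' j \<noteq> {}" for S
  proof -
    have "z \<in> closure S" for z
    proof (rule ccontr)
      assume "z \<notin> closure S"
      then obtain V where V: "V \<in> \<B>" "z \<in> V" "V \<subseteq> - closure S"
        using \<B>(3)[of "- closure S" z] by auto
      then have "V \<in> range O'"
        using range_O' by blast
      then show False
        using that V(3) closure_subset by fastforce
    qed
    then show ?thesis by blast
  qed

  \<comment> \<open>The first component of a label names the subspace, the second the open set to be hit.\<close>
  obtain p :: "'x \<Rightarrow> nat \<times> nat" where p: "\<And>c. |{a \<in> A. p a = c}| =o |A|"
    using infinite_labelling_by_countable[OF infA] by blast
  have "\<exists>y c. y \<in> Y \<and> c \<noteq> 0 \<and> y + scale c a \<in> O' (snd (p a))" for a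
  proof -
    have "Y \<inter> O' (snd (p a)) \<noteq> {}"
      using O' Y(2) by (metis inf_commute inf_top.right_neutral open_Int_closure_eq_empty)
    then obtain y where y: "y \<in> Y" "y \<in> O' (snd (p a))"
      by blast
    then obtain c where "c \<noteq> 0" "y + scale c a \<in> O' (snd (p a))"
      using open_contains_small_translate[OF O'(1) y(2), of a] by blast
    then show ?thesis
      using y(1) by blast
  qed
  then obtain y c where yc: "\<And>a. y a \<in> Y" "\<And>a. c a \<noteq> 0"
      "\<And>a. y a + scale (c a) a \<in> O' (snd (p a))"
    by metis
  \<comment> \<open>The factor \<open>inverse (c b)\<close> makes \<open>c b\<close> times the image \<open>b + h b\<close> equal to the point that was
    found in the open set, while the basis vector itself is unscaled. The perturbation vanishes at \<open>x\<close> so that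
    \<open>x\<close> stays in all the subspaces.\<close>
  obtain h where h: "Vector_Spaces.linear scale scale h"
      "\<forall>b\<in>B. h b = (if b = x then 0 else scale (inverse (c b)) (y b))"
    using linear_independent_extend[OF B,
        of "\<lambda>b. if b = x then 0 else scale (inverse (c b)) (y b)"] by blast
  interpret h: Vector_Spaces.linear scale scale h by (rule h(1))
  have hY: "h v \<in> Y" if "v \<in> span B" for v
  proof -
    have "h v \<in> span (h ` B)"
      using that h.span_image by blast
    also have "span (h ` B) \<subseteq> Y"
      using h(2) yc(1) Y(1) by (intro span_minimal) (auto intro: subspace_scale subspace_0)
    finally show ?thesis .
  qed
  define g where "g v = v + h v" for v
  interpret g: Vector_Spaces.linear scale scale g
    by unfold_locales (auto simp: g_def h.add h.scale algebra_simps scale_right_distrib)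
  have gx: "g x = x"
    using h(2) by (simp add: g_def B_def)
  have g_nz: "v = 0" if v: "v \<in> span B" and "g v = 0" for v
  proof -
    have "v = - h v"
      using that by (simp add: g_def eq_neg_iff_add_eq_0)
    then have "v \<in> Y"
      using hY[OF v] Y(1) subspace_neg by metis
    then show ?thesis
      using WY BW v by blast
  qed
  then have inj: "inj_on g (span B)"
    using g.inj_on_iff_eq_0[OF subspace_span] by blast

  define C where "C k = insert x {a \<in> A. fst (p a) = k}" for k
  have CB: "C k \<subseteq> B" for k
    by (auto simp: C_def B_def)
  define V where "V k = g ` span (C k)" for k
  have V_span: "V k = span (g ` C k)" for k
    by (simp add: V_def g.span_image)
  have "subspace (V k)" for k
    by (simp add: V_span)
  moreover have "closure (V k) = UNIV" for k
  proof (rule denseI)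
    fix j
    have "{a \<in> A. p a = (k, j)} \<noteq> {}"
      using p[of "(k, j)"] infA by (metis card_of_ordIso_finite finite.emptyI)
    then obtain a where a: "a \<in> A" "p a = (k, j)"
      by blast
    have "scale (c a) (g a) = y a + scale (c a) a"
      using a(1) h(2) xA yc(2) by (auto simp: g_def B_def scale_right_distrib add.commute)
    moreover have "scale (c a) (g a) \<in> V k"
      unfolding V_span using a by (intro span_scale span_base) (auto simp: C_def)
    ultimately show "V k \<inter> O' j \<noteq> {}"
      using yc(3)[of a] a(2) by auto
  qed
  moreover have "has_dim (V k) \<alpha>" for k
  proof -
    have "independent (g ` C k)"
      by (rule g.independent_injective_image[OF independent_mono[OF B CB]
            inj_on_subset[OF inj span_mono[OF CB]]])
    moreover have "|g ` C k| =o \<alpha>"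
    proof -
      have "inj_on g (C k)"
        using inj CB by (meson inj_on_subset span_superset subset_trans)
      then have "|g ` C k| =o |C k|"
        using card_of_ordIso inj_on_imp_bij_betw ordIso_symmetric by blast
      moreover have "|C k| =o |A|"
      proof -
        have "|C k| \<le>o |B|"
          using CB by (rule card_of_mono1)
        moreover have "|B| =o |A|"
          unfolding B_def using infA by (rule card_of_insert_infinite)
        ultimately have "|C k| \<le>o |A|"
          by (rule ordLeq_ordIso_trans)
        have "|{a \<in> A. p a = (k, 0)}| \<le>o |C k|"
          by (rule card_of_mono1) (auto simp: C_def)
        then have "|A| \<le>o |C k|"
          by (rule ordIso_ordLeq_trans[OF ordIso_symmetric[OF p]])
        with \<open>|C k| \<le>o |A|\<close> show ?thesis
          by (simp add: ordIso_iff_ordLeq)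
      qed
      ultimately show ?thesis
        using card_A ordIso_transitive by blast
    qed
    ultimately show ?thesis
      unfolding has_dim_def V_span by blast
  qed
  moreover have "x \<in> V k" for k
    unfolding V_def using gx by (intro image_eqI[of _ _ x] span_base) (auto simp: C_def)
  moreover have "V k \<subseteq> insert 0 ((W - {0}) + Y)" for k
  proof
    fix v assume "v \<in> V k"
    then obtain w where w: "w \<in> span B" "v = g w"
      using span_mono[OF CB] by (auto simp: V_def)
    show "v \<in> insert 0 ((W - {0}) + Y)"
    proof (cases "w = 0")
      case True
      then show ?thesis using w g.zero by simp
    next
      case False
      then show ?thesis
        using w BW hY[OF w(1)] by (auto simp: g_def intro!: set_plus_intro)
    qed
  qed
  moreover have "V k \<inter> V l = span {x}" if "l \<noteq> k" for k l
  proof -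
    have "V k \<inter> V l = g ` (span (C k) \<inter> span (C l))"
      unfolding V_def using inj span_mono[OF CB] by (intro inj_on_image_Int[symmetric]) auto
    also have "span (C k) \<inter> span (C l) = span (C k \<inter> C l)"
      by (rule span_Int_subsets_of_independent[OF B CB CB])
    also have "C k \<inter> C l = {x}"
      using that by (auto simp: C_def)
    also have "g ` span {x} = span {x}"
      using g.span_image[of "{x}"] gx by simp
    finally show ?thesis .
  qed
  ultimately show ?thesis
    by (intro exI[of _ V]) simp
qed

lemma infinitely_imp_pointwise_dense_lineable:
  assumes "infinitely_pointwise_dense_lineable \<alpha> M"
  shows "pointwise_dense_lineable \<alpha> M"
  unfolding pointwise_dense_lineable_def
proof
  fix x assume "x \<in> M"
  from bspec[OF assms[unfolded infinitely_pointwise_dense_lineable_def] this]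
  obtain V :: "nat \<Rightarrow> 'x set" where "\<forall>k. subspace (V k) \<and> closure (V k) = UNIV \<and>
      has_dim (V k) \<alpha> \<and> x \<in> V k \<and> V k \<subseteq> M \<union> {0} \<and>
      (\<forall>l. l \<noteq> k \<longrightarrow> V k \<inter> V l = span {x})"
    by (elim exE)
  then show "\<exists>W. subspace W \<and> closure W = UNIV \<and> has_dim W \<alpha> \<and> x \<in> W \<and> W \<subseteq> M \<union> {0}"
    by (intro exI[of _ "V 0"]) simp
qed

end

section \<open>Infinite pointwise dense lineability\<close>

theorem theorem2p3:
  fixes scale :: "'k::real_normed_field \<Rightarrow> 'x::topological_ab_group_add \<Rightarrow> 'x"
    and \<alpha> :: "'c rel"
    and M N :: "'x set"
  assumes "topological_vector_space scale"
    and "metrizable_space (euclidean :: 'x topology)"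
    and "separable_space (euclidean :: 'x topology)"
    and "Cinfinite \<alpha>"
    and "M \<noteq> {}"
    and "N \<noteq> {}"
    and "stronger_than M N"
    and "M \<inter> N = {}"
    and "topological_vector_space.dense_lineable scale N"
    and "topological_vector_space.pointwise_lineable scale \<alpha> M"
  shows "topological_vector_space.infinitely_pointwise_dense_lineable scale \<alpha> M
    \<and> topological_vector_space.pointwise_dense_lineable scale \<alpha> M"
proof -
  interpret topological_vector_space scale by (rule assms(1))
  have M_add_N: "m + n \<in> M" if "m \<in> M" "n \<in> N" for m n
    using assms(7) that unfolding stronger_than_def by blast
  have zero: "0 \<notin> M"
    using M_add_N[of 0] assms(6,8) by auto
  obtain Y where Y: "subspace Y" "closure Y = UNIV" "Y \<subseteq> N \<union> {0}"
    using assms(9) unfolding dense_lineable_def by (elim exE conjE)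
  have M_add_Y: "m + y \<in> M" if "m \<in> M" "y \<in> Y" for m y
  proof (cases "y = 0")
    case False
    then have "y \<in> N"
      using that(2) Y(3) by blast
    then show ?thesis
      using M_add_N[OF that(1)] by blast
  qed (use that(1) in simp)
  have "\<exists>V :: nat \<Rightarrow> 'x set. \<forall>k.
      subspace (V k) \<and> closure (V k) = UNIV \<and> has_dim (V k) \<alpha> \<and> x \<in> V k \<and>
      V k \<subseteq> M \<union> {0} \<and> (\<forall>l. l \<noteq> k \<longrightarrow> V k \<inter> V l = span {x})" if x: "x \<in> M" for x
  proof -
    obtain W where W: "subspace W" "has_dim W \<alpha>" "x \<in> W" "W \<subseteq> M \<union> {0}"
      using assms(10) x unfolding pointwise_lineable_def by blast
    have "W \<inter> Y \<subseteq> {0}"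
      using W(4) Y(3) assms(8) by blast
    moreover have "x \<noteq> 0"
      using x zero by blast
    ultimately obtain V :: "nat \<Rightarrow> 'x set" where V: "\<forall>k.
        subspace (V k) \<and> closure (V k) = UNIV \<and> has_dim (V k) \<alpha> \<and> x \<in> V k \<and>
        V k \<subseteq> insert 0 ((W - {0}) + Y) \<and> (\<forall>l. l \<noteq> k \<longrightarrow> V k \<inter> V l = span {x})"
      using tilted_dense_subspaces[OF metrizable_separable_imp_second_countable[OF assms(2,3)]
          assms(4) W(1-3) _ Y(1,2)] by blast
    have "insert 0 ((W - {0}) + Y) \<subseteq> M \<union> {0}"
      using W(4) M_add_Y by (auto elim!: set_plus_elim)
    then have "V k \<subseteq> M \<union> {0}" for k
      using V by (meson subset_trans)
    then show ?thesis
      using V by (intro exI[of _ V]) simp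
  qed
  then have "infinitely_pointwise_dense_lineable \<alpha> M"
    unfolding infinitely_pointwise_dense_lineable_def by (rule ballI)
  then show ?thesis
    using infinitely_imp_pointwise_dense_lineable by blast
qed

end
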